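(* Let $X\subset[0,1]$ be compact, let $\mu$ be a Borel probability measure supported on $X$, let $\Gamma\subset\mathbb{N}_0$, and assume that $(\mu,\Gamma)$ is a spectral pair. Then the pair $(\mu,\Gamma)$ has a boundary representation with kernel $k=k_{(\mu,\Gamma)}$ given by $$\overline{k(z,x)}=\sum_{\gamma\in\Gamma}\overline{e_\gamma(x)}\,z^\gamma,\quad (z\in\mathbb{D},\ x\in X).$$ Moreover, writing $k_z=k(z,\cdot)$, $$\langle k_z,k_w\rangle_{L^2(\mu)}=\sum_{\gamma\in\Gamma}(z\overline{w})^\gamma,\quad (z,w\in\mathbb{D}).$$ The representation $$f(z)=\int_X\overline{k(z,x)}\,\tilde f(x)\,d\mu(x)=\langle k(z,\cdot),\tilde f\rangle_{L^2(\mu)},\quad (z\in\mathbb{D}),$$ valid for $f\in\mathfrak{A}_\Gamma$, extends to all $f\in H^2(\Gamma)$; moreover, for $f\in H^2(\Gamma)$ one has $\tilde f\in L^2(X,\mu)$ and $$\|f\|_{H^2}=\|\tilde f\|_{L^2(\mu)}.$$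
   Context: $\mathbb{N}_0=\{0,1,2,\dots\}$; $\mathbb{D}$ is the open unit disk; $e_t(x)=e^{2\pi i tx}$. $(\mu,\Gamma)$ is a spectral pair if $\{e_\gamma:\gamma\in\Gamma\}$ is an orthonormal basis of $L^2(\mu)$. Inner products are conjugate-linear in the first variable: $\langle g,f\rangle_{L^2(\mu)}=\int\overline{g}f\,d\mu$. $H^2$ is the Hardy space of analytic functions $f(z)=\sum_{n\ge0}c_nz^n$ on $\mathbb{D}$ with $\|f\|_{H^2}^2=\sum|c_n|^2<\infty$. $\mathfrak{A}_\Gamma$ is the set of finite sums $\sum_{\gamma\in\Gamma}c_\gamma z^\gamma$ with complex coefficients. $H^2(\Gamma)$ is the closed subspace of $H^2$ spanned by $\{z^\gamma:\gamma\in\Gamma\}$, i.e. the functions $f(z)=\sum_{\gamma\in\Gamma}c_\gamma z^\gamma$ with $\sum_{\gamma\in\Gamma}|c_\gamma|^2<\infty$. For $f=\sum_{\gamma}c_\gamma z^\gamma\in\mathfrak{A}_\Gamma$, $\tilde f$ is the $\mathbb{Z}$-periodic function $\tilde f(x)=f(e^{2\pi i x})=\sum_\gamma c_\gamma e_\gamma(x)$, restricted to $X$. For $f=\sum_{\gamma\in\Gamma}c_\gamma z^\gamma\in H^2(\Gamma)$, $\tilde f=\sum_{\gamma\in\Gamma}c_\gamma e_\gamma$, with the series understood in $L^2(\mu)$. The pair $(\mu,\Gamma)$ has a boundary representation with kernel $k$ if: (a) $k:\mathbb{D}\times X\to\mathbb{C}$; (b) $k(z,\cdot)\in L^2(X,\mu)$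 for all $z\in\mathbb{D}$; (c) for all $f\in\mathfrak{A}_\Gamma$ and $z\in\mathbb{D}$, $f(z)=\int_X\overline{k(z,x)}\tilde f(x)\,d\mu(x)$. *)

theory Defs
  imports "HOL-Probability.Probability" "HOL-Complex_Analysis.Complex_Analysis"
begin

(* Members of L^2(M) are represented by square-integrable functions, not by
   classes modulo null sets. *)

definition l2_space :: "'a measure \<Rightarrow> ('a \<Rightarrow> complex) set" where
  "l2_space M = {f. f \<in> borel_measurable M \<and> integrable M (\<lambda>x. (norm (f x))\<^sup>2)}"

definition l2_inner :: "'a measure \<Rightarrow> ('a \<Rightarrow> complex) \<Rightarrow> ('a \<Rightarrow> complex) \<Rightarrow> complex" where
  "l2_inner M g f = (LINT x|M. cnj (g x) * f x)"

definition l2_norm :: "'a measure \<Rightarrow> ('a \<Rightarrow> complex) \<Rightarrow> real" where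
  "l2_norm M f = sqrt (LINT x|M. (norm (f x))\<^sup>2)"

(* The membership requirements matter: l2_norm is 0 on functions that are not
   square-integrable. *)

definition l2_has_sum ::
    "'a measure \<Rightarrow> ('i \<Rightarrow> 'a \<Rightarrow> complex) \<Rightarrow> 'i set \<Rightarrow> ('a \<Rightarrow> complex) \<Rightarrow> bool" where
  "l2_has_sum M u I g \<longleftrightarrow>
     (\<forall>i\<in>I. u i \<in> l2_space M) \<and> g \<in> l2_space M \<and>
     ((\<lambda>F. l2_norm M (\<lambda>x. (\<Sum>i\<in>F. u i x) - g x)) \<longlongrightarrow> 0) (finite_subsets_at_top I)"

(* Orthonormal family whose closed linear span is all of L^2(M). *)

definition l2_orthonormal_basis ::
    "'a measure \<Rightarrow> ('i \<Rightarrow> 'a \<Rightarrow> complex) \<Rightarrow> 'i set \<Rightarrow> bool" where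
  "l2_orthonormal_basis M u I \<longleftrightarrow>
     (\<forall>i\<in>I. u i \<in> l2_space M) \<and>
     (\<forall>i\<in>I. \<forall>j\<in>I. l2_inner M (u i) (u j) = (if i = j then 1 else 0)) \<and>
     (\<forall>f\<in>l2_space M. \<forall>\<epsilon>>0. \<exists>F c. finite F \<and> F \<subseteq> I \<and>
        l2_norm M (\<lambda>x. f x - (\<Sum>i\<in>F. c i * u i x)) < \<epsilon>)"

definition expo :: "real \<Rightarrow> real \<Rightarrow> complex" where
  "expo t x = exp (2 * of_real pi * \<i> * of_real t * of_real x)"

definition spectral_pair :: "real measure \<Rightarrow> real set \<Rightarrow> bool" where
  "spectral_pair \<mu> \<Gamma> \<longleftrightarrow> l2_orthonormal_basis \<mu> expo \<Gamma>"

(* Functions on the disk are total functions; the values of members of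
   hardy_space outside the open unit disk are irrelevant, and the coefficients
   are those of the Taylor expansion at 0. *)

definition taylor_coeff :: "(complex \<Rightarrow> complex) \<Rightarrow> nat \<Rightarrow> complex" where
  "taylor_coeff f n = fps_nth (fps_expansion f 0) n"

definition hardy_space :: "(complex \<Rightarrow> complex) set" where
  "hardy_space = {f. f holomorphic_on ball 0 1 \<and> summable (\<lambda>n. (norm (taylor_coeff f n))\<^sup>2)}"

definition hardy_norm :: "(complex \<Rightarrow> complex) \<Rightarrow> real" where
  "hardy_norm f = sqrt (\<Sum>n. (norm (taylor_coeff f n))\<^sup>2)"

definition hardy_subspace :: "nat set \<Rightarrow> (complex \<Rightarrow> complex) set" where
  "hardy_subspace \<Gamma> = {f \<in> hardy_space. \<exists>c :: nat \<Rightarrow> complex.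
     (\<lambda>\<gamma>. (norm (c \<gamma>))\<^sup>2) summable_on \<Gamma> \<and>
     (\<forall>z\<in>ball 0 1. ((\<lambda>\<gamma>. c \<gamma> * z ^ \<gamma>) has_sum f z) \<Gamma>)}"

definition gamma_polys :: "nat set \<Rightarrow> (complex \<Rightarrow> complex) set" where
  "gamma_polys \<Gamma> = {f. \<exists>F c. finite F \<and> F \<subseteq> \<Gamma> \<and> f = (\<lambda>z. \<Sum>\<gamma>\<in>F. c \<gamma> * z ^ \<gamma>)}"

definition poly_tilde :: "(complex \<Rightarrow> complex) \<Rightarrow> real \<Rightarrow> complex" where
  "poly_tilde f x = f (exp (2 * of_real pi * \<i> * of_real x))"

(* For f in hardy_subspace \<Gamma>, the boundary function is determined only up to
   \<mu>-null sets, so it is given as a relation: g is a representative of it. *)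

definition is_hardy_tilde ::
    "real measure \<Rightarrow> nat set \<Rightarrow> (complex \<Rightarrow> complex) \<Rightarrow> (real \<Rightarrow> complex) \<Rightarrow> bool" where
  "is_hardy_tilde \<mu> \<Gamma> f g \<longleftrightarrow>
     l2_has_sum \<mu> (\<lambda>\<gamma> x. taylor_coeff f \<gamma> * expo (real \<gamma>) x) \<Gamma> g"

(* \<mu> is a measure on the real line, so L^2(X,\<mu>) is L^2 of its restriction to X. *)

definition has_boundary_representation ::
    "real set \<Rightarrow> real measure \<Rightarrow> nat set \<Rightarrow> (complex \<Rightarrow> real \<Rightarrow> complex) \<Rightarrow> bool" where
  "has_boundary_representation X \<mu> \<Gamma> k \<longleftrightarrow>
     (\<forall>z\<in>ball 0 1. k z \<in> l2_space (restrict_space \<mu> X)) \<and>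
     (\<forall>f\<in>gamma_polys \<Gamma>. \<forall>z\<in>ball 0 1.
        f z = (LINT x:X|\<mu>. cnj (k z x) * poly_tilde f x))"

definition boundary_kernel :: "nat set \<Rightarrow> complex \<Rightarrow> real \<Rightarrow> complex" where
  "boundary_kernel \<Gamma> z x = cnj (\<Sum>\<^sub>\<infinity>\<gamma>\<in>\<Gamma>. cnj (expo (real \<gamma>) x) * z ^ \<gamma>)"

end

theory Submission
  imports Defs
begin

text \<open>
  Everything follows from one fact about an orthonormal family \<open>u\<close>: if
  \<open>g = (\<Sum>i. c i u i)\<close> in \<open>L\<^sup>2\<close>, then continuity of the inner product gives
  \<open>\<langle>h, g\<rangle> = (\<Sum>i. c i \<langle>h, u i\<rangle>)\<close> for every square-integrable \<open>h\<close>
  (\<open>l2_has_sum_inner\<close>). Taking \<open>h = u j\<close> identifies the coefficients of \<open>g\<close>, and then taking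
  \<open>h = g\<close> gives Parseval's identity.

  For \<open>\<bar>z\<bar> < 1\<close> the series \<open>(\<Sum>\<gamma>. (cnj z)\<^sup>\<gamma> e\<^sub>\<gamma>)\<close> defining \<open>k\<^sub>z\<close> is dominated by a geometric
  series, so it converges uniformly and therefore in \<open>L\<^sup>2(\<mu>)\<close>. Hence
  \<open>\<langle>k\<^sub>z, e\<^sub>\<gamma>\<rangle> = z\<^sup>\<gamma>\<close>: pairing with \<open>k\<^sub>z\<close> replaces the exponential \<open>e\<^sub>\<gamma>\<close> by the monomial
  \<open>z\<^sup>\<gamma>\<close>. Applied to any \<open>L\<^sup>2\<close>-convergent series \<open>g = (\<Sum>\<gamma>. c\<^sub>\<gamma> e\<^sub>\<gamma>)\<close> this gives
  \<open>\<langle>k\<^sub>z, g\<rangle> = (\<Sum>\<gamma>. c\<^sub>\<gamma> z\<^sup>\<gamma>)\<close> (\<open>boundary_kernel_inner_l2_sum\<close>). The reproducing formula on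
  polynomials, its extension to the Hardy subspace and the formula for \<open>\<langle>k\<^sub>z, k\<^sub>w\<rangle>\<close> are the
  cases where \<open>g\<close> is \<open>poly_tilde f\<close>, a boundary function of \<open>f\<close>, and \<open>k\<^sub>w\<close>.

  Uniqueness of power series expansions shows that the coefficients of a function in the Hardy
  subspace are its Taylor coefficients, so Parseval's identity is the equality of norms. The one
  substantial analytic ingredient is the existence of boundary functions: this is the
  Riesz--Fischer theorem (\<open>riesz_fischer\<close>), which rests on the completeness of
  \<open>L\<^sup>2\<close> (\<open>l2_complete\<close>).
\<close>

section \<open>Square-integrable functions\<close>

lemma l2_spaceD:
  assumes "f \<in> l2_space M"
  shows "f \<in> borel_measurable M" "integrable M (\<lambda>x. (norm (f x))\<^sup>2)"
  using assms by (auto simp: l2_space_def)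

lemma l2_integrable_mult:
  assumes "f \<in> l2_space M" "g \<in> l2_space M"
  shows "integrable M (\<lambda>x. f x * g x)"
proof -
  note [measurable] = l2_spaceD(1)[OF assms(1)] l2_spaceD(1)[OF assms(2)]
  have "integrable M (\<lambda>x. (norm (f x))\<^sup>2 + (norm (g x))\<^sup>2)"
    using assms by (intro Bochner_Integration.integrable_add l2_spaceD)
  moreover have "norm (f x * g x) \<le> norm ((norm (f x))\<^sup>2 + (norm (g x))\<^sup>2)" for x
  proof -
    have "0 \<le> norm (f x) * norm (g x)" by simp
    moreover have "2 * (norm (f x) * norm (g x)) \<le> (norm (f x))\<^sup>2 + (norm (g x))\<^sup>2"
      using sum_squares_bound[of "norm (f x)" "norm (g x)"] by (simp add: mult.assoc)
    ultimately have "norm (f x) * norm (g x) \<le> (norm (f x))\<^sup>2 + (norm (g x))\<^sup>2"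
      by linarith
    then show ?thesis by (simp add: norm_mult)
  qed
  ultimately show ?thesis
    by (intro Bochner_Integration.integrable_bound[of M _ "\<lambda>x. f x * g x"]) auto
qed

lemma l2_space_cnj: "f \<in> l2_space M \<Longrightarrow> (\<lambda>x. cnj (f x)) \<in> l2_space M"
  by (auto simp: l2_space_def intro: borel_measurable_continuous_on[OF continuous_on_cnj[OF continuous_on_id]])

lemma l2_space_cmult: "f \<in> l2_space M \<Longrightarrow> (\<lambda>x. c * f x) \<in> l2_space M"
  by (auto simp: l2_space_def norm_mult power_mult_distrib)

lemma l2_space_zero: "(\<lambda>x. 0) \<in> l2_space M"
  by (simp add: l2_space_def)

lemma l2_space_add:
  assumes "f \<in> l2_space M" "g \<in> l2_space M"
  shows "(\<lambda>x. f x + g x) \<in> l2_space M"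
proof -
  note [measurable] = l2_spaceD(1)[OF assms(1)] l2_spaceD(1)[OF assms(2)]
  have "integrable M (\<lambda>x. 2 * (norm (f x))\<^sup>2 + 2 * (norm (g x))\<^sup>2)"
    using assms by (intro Bochner_Integration.integrable_add integrable_mult_right l2_spaceD)
  moreover have "norm ((norm (f x + g x))\<^sup>2) \<le> norm (2 * (norm (f x))\<^sup>2 + 2 * (norm (g x))\<^sup>2)" for x
  proof -
    have "(norm (f x + g x))\<^sup>2 \<le> (norm (f x) + norm (g x))\<^sup>2"
      by (intro power_mono norm_triangle_ineq) auto
    then show ?thesis
      using sum_squares_bound[of "norm (f x)" "norm (g x)"] by (simp add: power2_sum)
  qed
  ultimately have "integrable M (\<lambda>x. (norm (f x + g x))\<^sup>2)"
    by (intro Bochner_Integration.integrable_bound[of M _ "\<lambda>x. (norm (f x + g x))\<^sup>2"]) auto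
  then show ?thesis by (simp add: l2_space_def)
qed

lemma l2_space_diff:
  assumes "f \<in> l2_space M" "g \<in> l2_space M"
  shows "(\<lambda>x. f x - g x) \<in> l2_space M"
  using l2_space_add[OF assms(1) l2_space_cmult[OF assms(2), of "-1"]] by simp

lemma l2_space_sum:
  assumes "\<And>i. i \<in> F \<Longrightarrow> u i \<in> l2_space M"
  shows "(\<lambda>x. \<Sum>i\<in>F. u i x) \<in> l2_space M"
  using assms
  by (induction F rule: infinite_finite_induct) (auto intro!: l2_space_add l2_space_zero)

lemma (in finite_measure) l2_space_bounded:
  assumes [measurable]: "f \<in> borel_measurable M" and "\<And>x. x \<in> space M \<Longrightarrow> norm (f x) \<le> B"
  shows "f \<in> l2_space M"
proof -
  have "norm ((norm (f x))\<^sup>2) \<le> B\<^sup>2" if "x \<in> space M" for x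
    using assms(2)[OF that] by (simp add: power_mono)
  then have "integrable M (\<lambda>x. (norm (f x))\<^sup>2)"
    by (intro integrable_const_bound[where B = "B\<^sup>2"]) auto
  then show ?thesis by (simp add: l2_space_def)
qed

lemma l2_norm_nonneg: "0 \<le> l2_norm M f"
  by (simp add: l2_norm_def)

lemma l2_norm_power2: "(l2_norm M f)\<^sup>2 = (LINT x|M. (norm (f x))\<^sup>2)"
  by (simp add: l2_norm_def)

lemma l2_inner_self: "l2_inner M f f = of_real ((l2_norm M f)\<^sup>2)"
proof -
  have "l2_inner M f f = (LINT x|M. complex_of_real ((norm (f x))\<^sup>2))"
    unfolding l2_inner_def
    by (intro Bochner_Integration.integral_cong) (auto simp: complex_norm_square mult.commute simp del: of_real_power)
  then show ?thesis by (simp only: integral_complex_of_real l2_norm_power2)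
qed

lemma l2_inner_diff_right:
  assumes "h \<in> l2_space M" "f \<in> l2_space M" "g \<in> l2_space M"
  shows "l2_inner M h (\<lambda>x. f x - g x) = l2_inner M h f - l2_inner M h g"
  using assms unfolding l2_inner_def
  by (simp add: right_diff_distrib l2_integrable_mult l2_space_cnj)

lemma l2_inner_sum_right:
  assumes "h \<in> l2_space M" "\<And>i. i \<in> F \<Longrightarrow> u i \<in> l2_space M"
  shows "l2_inner M h (\<lambda>x. \<Sum>i\<in>F. c i * u i x) = (\<Sum>i\<in>F. c i * l2_inner M h (u i))"
proof -
  have "l2_inner M h (\<lambda>x. \<Sum>i\<in>F. c i * u i x) = (LINT x|M. (\<Sum>i\<in>F. c i * (cnj (h x) * u i x)))"
    unfolding l2_inner_def by (simp add: sum_distrib_left mult_ac)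
  also have "\<dots> = (\<Sum>i\<in>F. LINT x|M. c i * (cnj (h x) * u i x))"
    using assms by (intro Bochner_Integration.integral_sum integrable_mult_right l2_integrable_mult l2_space_cnj) auto
  finally show ?thesis by (simp add: l2_inner_def)
qed

lemma l2_inner_commute: "l2_inner M f g = cnj (l2_inner M g f)"
proof -
  have "l2_inner M f g = (LINT x|M. cnj (cnj (g x) * f x))"
    unfolding l2_inner_def by (intro Bochner_Integration.integral_cong) auto
  then show ?thesis unfolding l2_inner_def Bochner_Integration.integral_cnj .
qed

text \<open>
  The form with absolute values inside the integral is needed for the triangle inequality and for
  comparing \<open>L\<^sup>1\<close> with \<open>L\<^sup>2\<close>; the usual inequality for the inner product follows from it.
\<close>

lemma l2_cauchy_schwarz_abs:
  assumes "f \<in> l2_space M" "g \<in> l2_space M"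
  shows "(LINT x|M. norm (f x) * norm (g x)) \<le> l2_norm M f * l2_norm M g"
proof -
  note [measurable] = l2_spaceD(1)[OF assms(1)] l2_spaceD(1)[OF assms(2)]
  have int: "integrable M (\<lambda>x. norm (f x) * norm (g x))"
    using integrable_norm[OF l2_integrable_mult[OF assms]] by (simp add: norm_mult)
  have "(\<integral>\<^sup>+x. ennreal (norm (f x)) * ennreal (norm (g x)) \<partial>M)\<^sup>2
      \<le> (\<integral>\<^sup>+x. ennreal (norm (f x)) ^ 2 \<partial>M) * (\<integral>\<^sup>+x. ennreal (norm (g x)) ^ 2 \<partial>M)"
    by (intro Cauchy_Schwarz_nn_integral) auto
  also have "(\<integral>\<^sup>+x. ennreal (norm (f x)) * ennreal (norm (g x)) \<partial>M)
      = ennreal (LINT x|M. norm (f x) * norm (g x))"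
    using int by (subst nn_integral_eq_integral[symmetric]) (auto simp: ennreal_mult)
  also have "(\<integral>\<^sup>+x. ennreal (norm (f x)) ^ 2 \<partial>M) = ennreal ((l2_norm M f)\<^sup>2)"
    unfolding l2_norm_power2 using l2_spaceD(2)[OF assms(1)]
    by (subst nn_integral_eq_integral[symmetric]) (auto simp: ennreal_power)
  also have "(\<integral>\<^sup>+x. ennreal (norm (g x)) ^ 2 \<partial>M) = ennreal ((l2_norm M g)\<^sup>2)"
    unfolding l2_norm_power2 using l2_spaceD(2)[OF assms(2)]
    by (subst nn_integral_eq_integral[symmetric]) (auto simp: ennreal_power)
  finally have "(LINT x|M. norm (f x) * norm (g x))\<^sup>2 \<le> (l2_norm M f * l2_norm M g)\<^sup>2"
    by (simp add: ennreal_power ennreal_mult[symmetric] power_mult_distrib)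
  then show ?thesis
    by (rule power2_le_imp_le) (simp add: l2_norm_nonneg)
qed

lemma l2_cauchy_schwarz:
  assumes "f \<in> l2_space M" "g \<in> l2_space M"
  shows "norm (l2_inner M f g) \<le> l2_norm M f * l2_norm M g"
proof -
  have "norm (l2_inner M f g) \<le> (LINT x|M. norm (f x) * norm (g x))"
    unfolding l2_inner_def using integral_norm_bound[of M "\<lambda>x. cnj (f x) * g x"]
    by (simp add: norm_mult)
  also have "\<dots> \<le> l2_norm M f * l2_norm M g"
    by (rule l2_cauchy_schwarz_abs[OF assms])
  finally show ?thesis .
qed

lemma l2_norm_triangle:
  assumes "f \<in> l2_space M" "g \<in> l2_space M"
  shows "l2_norm M (\<lambda>x. f x + g x) \<le> l2_norm M f + l2_norm M g"
proof (rule power2_le_imp_le)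
  note [measurable] = l2_spaceD(1)[OF assms(1)] l2_spaceD(1)[OF assms(2)]
  have int: "integrable M (\<lambda>x. norm (f x) * norm (g x))"
    using integrable_norm[OF l2_integrable_mult[OF assms]] by (simp add: norm_mult)
  have "(l2_norm M (\<lambda>x. f x + g x))\<^sup>2
      \<le> (LINT x|M. (norm (f x))\<^sup>2 + (norm (g x))\<^sup>2 + 2 * (norm (f x) * norm (g x)))"
    unfolding l2_norm_power2
  proof (rule integral_mono)
    fix x
    have "(norm (f x + g x))\<^sup>2 \<le> (norm (f x) + norm (g x))\<^sup>2"
      by (intro power_mono norm_triangle_ineq) auto
    then show "(norm (f x + g x))\<^sup>2 \<le> (norm (f x))\<^sup>2 + (norm (g x))\<^sup>2 + 2 * (norm (f x) * norm (g x))"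
      by (simp add: power2_sum)
  qed (intro Bochner_Integration.integrable_add integrable_mult_right int l2_spaceD l2_space_add assms)+
  also have "\<dots> = (l2_norm M f)\<^sup>2 + (l2_norm M g)\<^sup>2 + 2 * (LINT x|M. norm (f x) * norm (g x))"
    using assms int by (simp add: l2_norm_power2 l2_spaceD)
  also have "\<dots> \<le> (l2_norm M f + l2_norm M g)\<^sup>2"
    using l2_cauchy_schwarz_abs[OF assms] by (simp add: power2_sum)
  finally show "(l2_norm M (\<lambda>x. f x + g x))\<^sup>2 \<le> (l2_norm M f + l2_norm M g)\<^sup>2" .
qed (simp add: l2_norm_nonneg)

lemma l2_norm_minus_commute: "l2_norm M (\<lambda>x. f x - g x) = l2_norm M (\<lambda>x. g x - f x)"
  by (simp add: l2_norm_def norm_minus_commute)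

lemma l2_norm_diff_triangle:
  assumes "f \<in> l2_space M" "g \<in> l2_space M" "h \<in> l2_space M"
  shows "l2_norm M (\<lambda>x. f x - h x) \<le> l2_norm M (\<lambda>x. f x - g x) + l2_norm M (\<lambda>x. g x - h x)"
  using l2_norm_triangle[OF l2_space_diff[OF assms(1,2)] l2_space_diff[OF assms(2,3)]] by simp

lemma (in finite_measure) integral_norm_le_l2_norm:
  assumes "f \<in> l2_space M"
  shows "(LINT x|M. norm (f x)) \<le> l2_norm M (\<lambda>_. 1) * l2_norm M f"
proof -
  have "(\<lambda>_. 1) \<in> l2_space M" by (rule l2_space_bounded[where B = 1]) auto
  from l2_cauchy_schwarz_abs[OF this assms] show ?thesis by simp
qed

lemma (in finite_measure) l2_norm_le_sup:
  assumes "\<And>x. x \<in> space M \<Longrightarrow> norm (f x) \<le> B" "f \<in> borel_measurable M"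
  shows "l2_norm M f \<le> l2_norm M (\<lambda>_. 1) * B"
proof (rule power2_le_imp_le)
  have "(l2_norm M f)\<^sup>2 \<le> (LINT x|M. B\<^sup>2)"
    unfolding l2_norm_power2
  proof (rule integral_mono)
    show "integrable M (\<lambda>x. (norm (f x))\<^sup>2)"
      by (rule l2_spaceD(2)[OF l2_space_bounded[OF assms(2,1)]])
    show "(norm (f x))\<^sup>2 \<le> B\<^sup>2" if "x \<in> space M" for x
      using assms(1)[OF that] by (simp add: power_mono)
  qed simp
  also have "\<dots> = (l2_norm M (\<lambda>_. 1) * B)\<^sup>2"
    by (simp add: power_mult_distrib l2_norm_power2)
  finally show "(l2_norm M f)\<^sup>2 \<le> (l2_norm M (\<lambda>_. 1) * B)\<^sup>2" .
next
  show "0 \<le> l2_norm M (\<lambda>_. 1) * B"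
  proof (cases "space M = {}")
    case True
    then show ?thesis by (simp add: l2_norm_def)
  next
    case False
    then obtain x where "x \<in> space M" by blast
    then have "0 \<le> B" using assms(1) norm_ge_zero order_trans by blast
    then show ?thesis by (simp add: l2_norm_nonneg)
  qed
qed

section \<open>Completeness\<close>

text \<open>
  On a finite measure space, an \<open>L\<^sup>2\<close>-Cauchy sequence is \<open>L\<^sup>1\<close>-Cauchy, so some subsequence
  converges almost everywhere. By Fatou's lemma the pointwise limit is also the
  \<open>L\<^sup>2\<close>-limit of the full sequence.
\<close>

theorem (in finite_measure) l2_complete:
  assumes s: "\<And>n. s n \<in> l2_space M"
    and cauchy: "\<And>e. e > 0 \<Longrightarrow> \<exists>N. \<forall>i\<ge>N. \<forall>j\<ge>N. l2_norm M (\<lambda>x. s i x - s j x) < e"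
  obtains g where "g \<in> l2_space M" "(\<lambda>n. l2_norm M (\<lambda>x. s n x - g x)) \<longlonglongrightarrow> 0"
proof -
  note [measurable] = l2_spaceD(1)[OF s]
  have one: "(\<lambda>_. 1) \<in> l2_space M" by (rule l2_space_bounded[where B = 1]) auto
  have int: "integrable M (s n)" for n
    using l2_integrable_mult[OF one s] by simp
  have "\<exists>N. \<forall>i\<ge>N. \<forall>j\<ge>N. LINT x|M. norm (s i x - s j x) < e" if e: "e > 0" for e
  proof -
    \<comment> \<open>The added 1 keeps C positive, even if the space is a null set.\<close>
    define C where "C = l2_norm M (\<lambda>_. 1) + 1"
    have C: "C > 0" using l2_norm_nonneg[of M "\<lambda>_. 1"] by (simp add: C_def)
    obtain N where N: "\<And>i j. i \<ge> N \<Longrightarrow> j \<ge> N \<Longrightarrow> l2_norm M (\<lambda>x. s i x - s j x) < e / C"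
      using cauchy[of "e / C"] e C by (metis divide_pos_pos)
    have "(LINT x|M. norm (s i x - s j x)) < e" if "i \<ge> N" "j \<ge> N" for i j
    proof -
      have "(LINT x|M. norm (s i x - s j x)) \<le> C * l2_norm M (\<lambda>x. s i x - s j x)"
        using integral_norm_le_l2_norm[OF l2_space_diff[OF s s], of i j]
          l2_norm_nonneg[of M "\<lambda>x. s i x - s j x"] by (simp add: C_def algebra_simps)
      also have "\<dots> < C * (e / C)"
        using N[OF that] C by (intro mult_strict_left_mono) auto
      finally show ?thesis using C by simp
    qed
    then show ?thesis by blast
  qed
  from cauchy_L1_AE_cauchy_subseq[OF int this]
  obtain r where r: "strict_mono r" "AE x in M. Cauchy (\<lambda>i. s (r i) x)" by auto
  \<comment> \<open>Where the subsequence diverges, g has an arbitrary value; that is a null set.\<close>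
  define g where "g x = lim (\<lambda>i. s (r i) x)" for x
  have g_meas[measurable]: "g \<in> borel_measurable M"
    unfolding g_def by measurable
  have lim: "AE x in M. (\<lambda>i. s (r i) x) \<longlonglongrightarrow> g x"
    using r(2) by eventually_elim (simp add: g_def Cauchy_convergent convergent_LIMSEQ_iff[symmetric])
  \<comment> \<open>Fatou's lemma, applied to the tail of the subsequence.\<close>
  have near: "(\<lambda>x. s n x - g x) \<in> l2_space M \<and> l2_norm M (\<lambda>x. s n x - g x) \<le> e"
    if "e > 0" and N: "\<And>i j. i \<ge> N \<Longrightarrow> j \<ge> N \<Longrightarrow> l2_norm M (\<lambda>x. s i x - s j x) < e" and n: "n \<ge> N"
    for e N n
  proof -
    have "(\<integral>\<^sup>+x. ennreal ((norm (s n x - g x))\<^sup>2) \<partial>M)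
        = (\<integral>\<^sup>+x. liminf (\<lambda>i. ennreal ((norm (s n x - s (r i) x))\<^sup>2)) \<partial>M)"
    proof (rule nn_integral_cong_AE)
      show "AE x in M. ennreal ((norm (s n x - g x))\<^sup>2)
          = liminf (\<lambda>i. ennreal ((norm (s n x - s (r i) x))\<^sup>2))"
        using lim
      proof eventually_elim
        case (elim x)
        have "(\<lambda>i. ennreal ((norm (s n x - s (r i) x))\<^sup>2)) \<longlonglongrightarrow> ennreal ((norm (s n x - g x))\<^sup>2)"
          by (intro tendsto_ennrealI tendsto_intros elim)
        from lim_imp_Liminf[OF sequentially_bot this] show ?case by simp
      qed
    qed
    also have "\<dots> \<le> liminf (\<lambda>i. \<integral>\<^sup>+x. ennreal ((norm (s n x - s (r i) x))\<^sup>2) \<partial>M)"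
      by (rule nn_integral_liminf) measurable
    also have "\<dots> \<le> ennreal (e\<^sup>2)"
    proof (rule Liminf_le)
      show "eventually (\<lambda>i. (\<integral>\<^sup>+x. ennreal ((norm (s n x - s (r i) x))\<^sup>2) \<partial>M) \<le> ennreal (e\<^sup>2)) sequentially"
        using eventually_ge_at_top[of N]
      proof eventually_elim
        case (elim i)
        then have "r i \<ge> N" using seq_suble[OF r(1), of i] by linarith
        then have "(l2_norm M (\<lambda>x. s n x - s (r i) x))\<^sup>2 \<le> e\<^sup>2"
          using N[OF n, of "r i"] by (intro power_mono) (auto simp: l2_norm_nonneg)
        then show ?case
          using l2_spaceD(2)[OF l2_space_diff[OF s s], of n "r i"]
          by (subst nn_integral_eq_integral) (auto simp: l2_norm_power2)
      qed
    qed simp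
    finally have le: "(\<integral>\<^sup>+x. ennreal ((norm (s n x - g x))\<^sup>2) \<partial>M) \<le> ennreal (e\<^sup>2)" .
    then have "integrable M (\<lambda>x. (norm (s n x - g x))\<^sup>2)"
      by (intro integrableI_nonneg) (auto intro: le_less_trans)
    then have mem: "(\<lambda>x. s n x - g x) \<in> l2_space M"
      by (simp add: l2_space_def)
    have "(l2_norm M (\<lambda>x. s n x - g x))\<^sup>2 \<le> e\<^sup>2"
      using le l2_spaceD(2)[OF mem] by (subst (asm) nn_integral_eq_integral) (auto simp: l2_norm_power2)
    then show ?thesis
      using mem \<open>e > 0\<close> by (auto intro: power2_le_imp_le)
  qed
  show ?thesis
  proof
    obtain N where "\<And>i j. i \<ge> N \<Longrightarrow> j \<ge> N \<Longrightarrow> l2_norm M (\<lambda>x. s i x - s j x) < 1"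
      using cauchy[of 1] by auto
    from near[OF _ this order_refl] have "(\<lambda>x. s N x - g x) \<in> l2_space M" by simp
    from l2_space_diff[OF s this, of N] show "g \<in> l2_space M" by simp
    show "(\<lambda>n. l2_norm M (\<lambda>x. s n x - g x)) \<longlonglongrightarrow> 0"
    proof (rule LIMSEQ_I)
      fix e :: real assume "e > 0"
      obtain N where N: "\<And>i j. i \<ge> N \<Longrightarrow> j \<ge> N \<Longrightarrow> l2_norm M (\<lambda>x. s i x - s j x) < e / 2"
        using cauchy[of "e / 2"] \<open>e > 0\<close> by auto
      show "\<exists>N. \<forall>n\<ge>N. norm (l2_norm M (\<lambda>x. s n x - g x) - 0) < e"
        using near[OF _ N] \<open>e > 0\<close> l2_norm_nonneg[of M] by (intro exI[of _ N]) force
    qed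
  qed
qed

section \<open>Orthonormal series\<close>

lemma l2_has_sumD:
  assumes "l2_has_sum M u I g"
  shows "\<And>i. i \<in> I \<Longrightarrow> u i \<in> l2_space M" "g \<in> l2_space M"
    "((\<lambda>F. l2_norm M (\<lambda>x. (\<Sum>i\<in>F. u i x) - g x)) \<longlongrightarrow> 0) (finite_subsets_at_top I)"
  using assms by (auto simp: l2_has_sum_def)

text \<open>
  By Cauchy--Schwarz, pairing with a fixed \<open>h\<close> is continuous, hence it may be carried out
  term by term in an \<open>L\<^sup>2\<close>-convergent series. The terms are split as \<open>c i * u i\<close> because in
  all applications \<open>u\<close> is orthonormal and \<open>c\<close> is its coefficient family.
\<close>

lemma l2_has_sum_inner:
  assumes "l2_has_sum M (\<lambda>i x. c i * u i x) I g" and u: "\<And>i. i \<in> I \<Longrightarrow> u i \<in> l2_space M"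
    and h: "h \<in> l2_space M"
  shows "((\<lambda>i. c i * l2_inner M h (u i)) has_sum l2_inner M h g) I"
proof -
  note D = l2_has_sumD[OF assms(1)]
  have "((\<lambda>F. (\<Sum>i\<in>F. c i * l2_inner M h (u i)) - l2_inner M h g) \<longlongrightarrow> 0) (finite_subsets_at_top I)"
  proof (rule Lim_null_comparison)
    show "((\<lambda>F. l2_norm M h * l2_norm M (\<lambda>x. (\<Sum>i\<in>F. c i * u i x) - g x)) \<longlongrightarrow> 0)
        (finite_subsets_at_top I)"
      by (intro tendsto_mult_right_zero D(3))
    show "eventually (\<lambda>F. norm ((\<Sum>i\<in>F. c i * l2_inner M h (u i)) - l2_inner M h g)
        \<le> l2_norm M h * l2_norm M (\<lambda>x. (\<Sum>i\<in>F. c i * u i x) - g x)) (finite_subsets_at_top I)"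
    proof (rule eventually_finite_subsets_at_top_weakI)
      fix F assume F: "finite F" "F \<subseteq> I"
      have mem: "(\<lambda>x. \<Sum>i\<in>F. c i * u i x) \<in> l2_space M"
        using F D(1) by (intro l2_space_sum) auto
      have "(\<Sum>i\<in>F. c i * l2_inner M h (u i)) - l2_inner M h g
          = l2_inner M h (\<lambda>x. (\<Sum>i\<in>F. c i * u i x) - g x)"
        using F u h mem D(2) by (subst l2_inner_diff_right, simp_all) (subst l2_inner_sum_right, auto)
      also have "norm \<dots> \<le> l2_norm M h * l2_norm M (\<lambda>x. (\<Sum>i\<in>F. c i * u i x) - g x)"
        by (intro l2_cauchy_schwarz h l2_space_diff mem D(2))
      finally show "norm ((\<Sum>i\<in>F. c i * l2_inner M h (u i)) - l2_inner M h g)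
        \<le> l2_norm M h * l2_norm M (\<lambda>x. (\<Sum>i\<in>F. c i * u i x) - g x)" .
    qed
  qed
  then show ?thesis unfolding has_sum_def by (rule LIM_zero_cancel)
qed

definition l2_orthonormal :: "'a measure \<Rightarrow> ('i \<Rightarrow> 'a \<Rightarrow> complex) \<Rightarrow> 'i set \<Rightarrow> bool" where
  "l2_orthonormal M u I \<longleftrightarrow> (\<forall>i\<in>I. u i \<in> l2_space M) \<and>
     (\<forall>i\<in>I. \<forall>j\<in>I. l2_inner M (u i) (u j) = (if i = j then 1 else 0))"

lemma l2_orthonormalD:
  assumes "l2_orthonormal M u I"
  shows "\<And>i. i \<in> I \<Longrightarrow> u i \<in> l2_space M"
    "\<And>i j. i \<in> I \<Longrightarrow> j \<in> I \<Longrightarrow> l2_inner M (u i) (u j) = (if i = j then 1 else 0)"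
  using assms by (auto simp: l2_orthonormal_def)

lemma l2_orthonormal_coeff:
  assumes "l2_orthonormal M u I" "l2_has_sum M (\<lambda>i x. c i * u i x) I g" "j \<in> I"
  shows "l2_inner M (u j) g = c j"
proof -
  note u = l2_orthonormalD[OF assms(1)]
  have "((\<lambda>i. c i * l2_inner M (u j) (u i)) has_sum l2_inner M (u j) g) I"
    by (rule l2_has_sum_inner[OF assms(2)]) (use u assms in auto)
  moreover have "((\<lambda>i. c i * l2_inner M (u j) (u i)) has_sum c j) I"
    by (rule has_sum_finite_neutralI[of "{j}"]) (use u assms in auto)
  ultimately show ?thesis using has_sum_unique by blast
qed

text \<open>
  Pair \<open>g\<close> with itself: the \<open>i\<close>-th term is \<open>c i\<close> times \<open>\<langle>g, u i\<rangle>\<close>, and the latter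
  is the conjugate of the \<open>i\<close>-th coefficient.
\<close>

lemma l2_orthonormal_parseval:
  assumes "l2_orthonormal M u I" "l2_has_sum M (\<lambda>i x. c i * u i x) I g"
  shows "((\<lambda>i. (norm (c i))\<^sup>2) has_sum (l2_norm M g)\<^sup>2) I"
proof -
  note u = l2_orthonormalD[OF assms(1)]
  have "((\<lambda>i. c i * l2_inner M g (u i)) has_sum l2_inner M g g) I"
    by (rule l2_has_sum_inner[OF assms(2)]) (use u l2_has_sumD[OF assms(2)] in auto)
  moreover have "c i * l2_inner M g (u i) = of_real ((norm (c i))\<^sup>2)" if "i \<in> I" for i
    using l2_orthonormal_coeff[OF assms that] l2_inner_commute[of M g "u i"]
    by (simp add: complex_norm_square del: of_real_power)
  ultimately have "((\<lambda>i. complex_of_real ((norm (c i))\<^sup>2)) has_sum of_real ((l2_norm M g)\<^sup>2)) I"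
    using has_sum_cong[of I "\<lambda>i. c i * l2_inner M g (u i)" "\<lambda>i. complex_of_real ((norm (c i))\<^sup>2)"]
    by (simp add: l2_inner_self)
  then show ?thesis using has_sum_of_real_iff by blast
qed

lemma l2_orthonormal_norm_sum:
  assumes "l2_orthonormal M u I" "finite F" "F \<subseteq> I"
  shows "(l2_norm M (\<lambda>x. \<Sum>i\<in>F. c i * u i x))\<^sup>2 = (\<Sum>i\<in>F. (norm (c i))\<^sup>2)"
proof -
  have "l2_orthonormal M u F" using assms unfolding l2_orthonormal_def by blast
  moreover have "l2_has_sum M (\<lambda>i x. c i * u i x) F (\<lambda>x. \<Sum>i\<in>F. c i * u i x)"
    unfolding l2_has_sum_def using assms l2_orthonormalD(1)[OF assms(1)]
    by (auto intro!: l2_space_cmult l2_space_sum tendsto_eventually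
        simp: finite_subsets_at_top_finite eventually_principal l2_norm_def)
  ultimately have "((\<lambda>i. (norm (c i))\<^sup>2) has_sum (l2_norm M (\<lambda>x. \<Sum>i\<in>F. c i * u i x))\<^sup>2) F"
    by (rule l2_orthonormal_parseval)
  then show ?thesis using has_sum_finite_iff[OF assms(2)] by blast
qed

text \<open>
  The partial sums form a Cauchy net, since the square of the norm of a block
  \<open>(\<Sum>i\<in>F - A. c i u i)\<close> is a block of the convergent series of \<open>\<bar>c i\<bar>\<^sup>2\<close>. As completeness is a
  statement about sequences, it is applied to the sums over finite sets \<open>A n\<close> beyond which
  all blocks have norm less than \<open>1 / (n + 1)\<close>; the net then has the same limit.
\<close>

theorem (in finite_measure) riesz_fischer:
  assumes on: "l2_orthonormal M u I" and summ: "(\<lambda>i. (norm (c i))\<^sup>2) summable_on I"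
  obtains g where "l2_has_sum M (\<lambda>i x. c i * u i x) I g"
proof -
  note u = l2_orthonormalD[OF on]
  define S where "S F x = (\<Sum>i\<in>F. c i * u i x)" for F x
  have S: "S F \<in> l2_space M" if "F \<subseteq> I" for F
    unfolding S_def using that u by (intro l2_space_sum l2_space_cmult) auto
  define close where "close e A \<longleftrightarrow> finite A \<and> A \<subseteq> I \<and>
      (\<forall>F. finite F \<and> A \<subseteq> F \<and> F \<subseteq> I \<longrightarrow> l2_norm M (\<lambda>x. S F x - S A x) < e)" for e A
  have close: "\<exists>A. close e A" if e: "e > 0" for e
  proof -
    obtain T where "((\<lambda>i. (norm (c i))\<^sup>2) has_sum T) I"
      using summ by (auto simp: summable_on_def)
    then have "eventually (\<lambda>F. dist (\<Sum>i\<in>F. (norm (c i))\<^sup>2) T < e\<^sup>2 / 2) (finite_subsets_at_top I)"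
      unfolding has_sum_def using e by (intro tendstoD) auto
    then obtain A where A: "finite A" "A \<subseteq> I"
      "\<And>F. finite F \<Longrightarrow> A \<subseteq> F \<Longrightarrow> F \<subseteq> I \<Longrightarrow> dist (\<Sum>i\<in>F. (norm (c i))\<^sup>2) T < e\<^sup>2 / 2"
      unfolding eventually_finite_subsets_at_top by metis
    have "l2_norm M (\<lambda>x. S F x - S A x) < e" if F: "finite F" "A \<subseteq> F" "F \<subseteq> I" for F
    proof (rule power2_less_imp_less)
      have "S F x - S A x = S (F - A) x" for x
        unfolding S_def using F by (simp add: sum_diff)
      then have "(l2_norm M (\<lambda>x. S F x - S A x))\<^sup>2 = (\<Sum>i\<in>F - A. (norm (c i))\<^sup>2)"
        using l2_orthonormal_norm_sum[OF on, of "F - A" c] F by (auto simp: S_def)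
      also have "\<dots> = (\<Sum>i\<in>F. (norm (c i))\<^sup>2) - (\<Sum>i\<in>A. (norm (c i))\<^sup>2)"
        using F by (simp add: sum_diff)
      also have "\<dots> < e\<^sup>2"
        using A(3)[OF F] A(3)[OF A(1) order_refl A(2)]
        unfolding dist_real_def by linarith
      finally show "(l2_norm M (\<lambda>x. S F x - S A x))\<^sup>2 < e\<^sup>2" .
    qed (use that \<open>e > 0\<close> in auto)
    then show ?thesis using A(1,2) unfolding close_def by blast
  qed
  define A where "A n = (SOME A. close (inverse (real (Suc n))) A)" for n
  have "close (inverse (real (Suc n))) (A n)" for n
    unfolding A_def by (rule someI_ex, rule close) simp
  then have A: "\<And>n. finite (A n)" "\<And>n. A n \<subseteq> I"
    "\<And>n F. finite F \<Longrightarrow> A n \<subseteq> F \<Longrightarrow> F \<subseteq> I \<Longrightarrow>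
       l2_norm M (\<lambda>x. S F x - S (A n) x) < inverse (real (Suc n))"
    unfolding close_def by blast+
  have small: "\<exists>N. \<forall>n\<ge>N. inverse (real (Suc n)) < e" if "e > 0" for e
  proof -
    obtain N where "inverse (real (Suc N)) < e" using reals_Archimedean[OF \<open>e > 0\<close>] by auto
    then show ?thesis
      by (intro exI[of _ N]) (auto intro: le_less_trans[rotated] simp: le_imp_inverse_le)
  qed
  obtain g where g: "g \<in> l2_space M" "(\<lambda>n. l2_norm M (\<lambda>x. S (A n) x - g x)) \<longlonglongrightarrow> 0"
  proof (rule l2_complete)
    show "S (A n) \<in> l2_space M" for n using S A by blast
    fix e :: real assume "e > 0"
    then obtain N where N: "\<And>n. n \<ge> N \<Longrightarrow> inverse (real (Suc n)) < e / 2"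
      using small[of "e / 2"] by auto
    have "l2_norm M (\<lambda>x. S (A i) x - S (A j) x) < e" if "i \<ge> N" "j \<ge> N" for i j
    proof -
      \<comment> \<open>The sets A n need not be nested, so both sums are compared with the sum over the union.\<close>
      have "l2_norm M (\<lambda>x. S (A i) x - S (A j) x)
          \<le> l2_norm M (\<lambda>x. S (A i) x - S (A i \<union> A j) x) + l2_norm M (\<lambda>x. S (A i \<union> A j) x - S (A j) x)"
        by (intro l2_norm_diff_triangle S) (use A in auto)
      moreover have "l2_norm M (\<lambda>x. S (A i \<union> A j) x - S (A j) x) < e / 2"
        using A(3)[where n = j and F = "A i \<union> A j"] A(1,2) N[OF that(2)] by force
      moreover have "l2_norm M (\<lambda>x. S (A i) x - S (A i \<union> A j) x) < e / 2"
        using A(3)[where n = i and F = "A i \<union> A j"] A(1,2) N[OF that(1)]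
        by (subst l2_norm_minus_commute) force
      ultimately show ?thesis by linarith
    qed
    then show "\<exists>N. \<forall>i\<ge>N. \<forall>j\<ge>N. l2_norm M (\<lambda>x. S (A i) x - S (A j) x) < e" by blast
  qed
  have "((\<lambda>F. l2_norm M (\<lambda>x. S F x - g x)) \<longlongrightarrow> 0) (finite_subsets_at_top I)"
  proof (rule tendstoI)
    fix e :: real assume "e > 0"
    obtain N where N: "\<And>n. n \<ge> N \<Longrightarrow> inverse (real (Suc n)) < e / 2"
      using small[of "e / 2"] \<open>e > 0\<close> by auto
    obtain N' where N': "\<And>n. n \<ge> N' \<Longrightarrow> l2_norm M (\<lambda>x. S (A n) x - g x) < e / 2"
      using LIMSEQ_D[OF g(2), of "e / 2"] \<open>e > 0\<close> by (auto simp: l2_norm_nonneg)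
    define n where "n = max N N'"
    have "l2_norm M (\<lambda>x. S F x - g x) < e" if "finite F" "A n \<subseteq> F" "F \<subseteq> I" for F
      using l2_norm_diff_triangle[OF S[OF that(3)] S[OF A(2)] g(1), of n]
        A(3)[OF that] N[of n] N'[of n] by (simp add: n_def)
    then show "eventually (\<lambda>F. dist (l2_norm M (\<lambda>x. S F x - g x)) 0 < e) (finite_subsets_at_top I)"
      unfolding eventually_finite_subsets_at_top using A(1,2)
      by (intro exI[of _ "A n"]) (auto simp: l2_norm_nonneg)
  qed
  then have "l2_has_sum M (\<lambda>i x. c i * u i x) I g"
    unfolding l2_has_sum_def S_def using u g(1) by (auto intro: l2_space_cmult)
  then show ?thesis by (rule that)
qed

text \<open>
  The Weierstrass M-test gives uniform convergence, and a uniform bound on a finite measure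
  space is an \<open>L\<^sup>2\<close> bound.
\<close>

lemma (in finite_measure) l2_has_sum_dominated:
  assumes u: "\<And>i. i \<in> I \<Longrightarrow> u i \<in> borel_measurable M" and g: "g \<in> borel_measurable M"
    and sum: "\<And>x. x \<in> space M \<Longrightarrow> ((\<lambda>i. u i x) has_sum g x) I"
    and bound: "\<And>i x. i \<in> I \<Longrightarrow> x \<in> space M \<Longrightarrow> norm (u i x) \<le> b i"
    and b: "b summable_on I"
  shows "l2_has_sum M u I g"
proof -
  obtain B where B: "(b has_sum B) I" using b by (auto simp: summable_on_def)
  have rest: "norm ((\<Sum>i\<in>F. u i x) - g x) \<le> B - (\<Sum>i\<in>F. b i)"
    if F: "finite F" "F \<subseteq> I" and x: "x \<in> space M" for F x
  proof -
    have "((\<lambda>i. u i x) has_sum (g x - (\<Sum>i\<in>F. u i x))) (I - F)"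
      by (rule has_sum_Diff[OF sum[OF x] has_sum_finite[OF F(1)] F(2)])
    moreover have "(b has_sum (B - (\<Sum>i\<in>F. b i))) (I - F)"
      by (rule has_sum_Diff[OF B has_sum_finite[OF F(1)] F(2)])
    ultimately have "norm (g x - (\<Sum>i\<in>F. u i x)) \<le> B - (\<Sum>i\<in>F. b i)"
      by (rule norm_infsum_le) (use bound x in auto)
    then show ?thesis by (simp add: norm_minus_commute)
  qed
  have u_mem: "u i \<in> l2_space M" if "i \<in> I" for i
    by (rule l2_space_bounded[OF u[OF that] bound[OF that]])
  have "norm (g x) \<le> B" if "x \<in> space M" for x
    using rest[of "{}" x] that by simp
  then have g_mem: "g \<in> l2_space M"
    by (rule l2_space_bounded[OF g])
  have "((\<lambda>F. l2_norm M (\<lambda>x. (\<Sum>i\<in>F. u i x) - g x)) \<longlongrightarrow> 0) (finite_subsets_at_top I)"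
  proof (rule Lim_null_comparison)
    have "((\<lambda>F. l2_norm M (\<lambda>_. 1) * (B - (\<Sum>i\<in>F. b i))) \<longlongrightarrow> l2_norm M (\<lambda>_. 1) * (B - B))
        (finite_subsets_at_top I)"
      using B unfolding has_sum_def by (intro tendsto_intros)
    then show "((\<lambda>F. l2_norm M (\<lambda>_. 1) * (B - (\<Sum>i\<in>F. b i))) \<longlongrightarrow> 0) (finite_subsets_at_top I)"
      by simp
    show "eventually (\<lambda>F. norm (l2_norm M (\<lambda>x. (\<Sum>i\<in>F. u i x) - g x))
        \<le> l2_norm M (\<lambda>_. 1) * (B - (\<Sum>i\<in>F. b i))) (finite_subsets_at_top I)"
    proof (rule eventually_finite_subsets_at_top_weakI)
      fix F assume F: "finite F" "F \<subseteq> I"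
      have meas: "(\<lambda>x. (\<Sum>i\<in>F. u i x) - g x) \<in> borel_measurable M"
        using F u g by (intro borel_measurable_diff borel_measurable_sum) auto
      show "norm (l2_norm M (\<lambda>x. (\<Sum>i\<in>F. u i x) - g x)) \<le> l2_norm M (\<lambda>_. 1) * (B - (\<Sum>i\<in>F. b i))"
        using l2_norm_le_sup[OF rest[OF F] meas] by (simp add: l2_norm_nonneg)
    qed
  qed
  then show ?thesis
    unfolding l2_has_sum_def using u_mem g_mem by auto
qed

section \<open>Restriction to a set of full measure\<close>

lemma l2_space_restrict_space:
  assumes "f \<in> l2_space M" "X \<in> sets M"
  shows "f \<in> l2_space (restrict_space M X)"
proof -
  have X: "X \<inter> space M \<in> sets M" using assms(2) by (intro sets.Int) auto
  show ?thesis
    unfolding l2_space_def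
    using assms l2_spaceD[OF assms(1)] integrable_mult_indicator[OF assms(2), of "\<lambda>x. (norm (f x))\<^sup>2"]
    by (auto intro: measurable_restrict_space1 simp: integrable_restrict_space[OF X])
qed

lemma set_integral_full:
  fixes h :: "'a \<Rightarrow> 'b::{banach, second_countable_topology}"
  assumes [measurable]: "h \<in> borel_measurable M" "X \<in> sets M" and null: "emeasure M (space M - X) = 0"
  shows "(LINT x:X|M. h x) = (LINT x|M. h x)"
  unfolding set_lebesgue_integral_def
proof (rule integral_cong_AE)
  have "AE x in M. x \<in> X"
    by (rule AE_I[OF _ null]) auto
  then show "AE x in M. indicator X x *\<^sub>R h x = h x"
    by eventually_elim simp
qed measurable

section \<open>The kernel\<close>

lemma norm_expo [simp]: "norm (expo t x) = 1"
proof -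
  have "2 * of_real pi * \<i> * of_real t * of_real x = \<i> * complex_of_real (2 * pi * t * x)"
    by (simp add: mult_ac)
  then show ?thesis unfolding expo_def by (simp only: norm_exp_i_times)
qed

lemma expo_of_nat: "expo (real n) x = exp (2 * of_real pi * \<i> * of_real x) ^ n"
proof -
  have "2 * of_real pi * \<i> * of_real (real n) * of_real x
      = of_nat n * (2 * of_real pi * \<i> * of_real x :: complex)"
    by (simp add: mult_ac)
  then show ?thesis unfolding expo_def by (simp only: exp_of_nat_mult)
qed

lemma borel_measurable_expo [measurable]: "expo t \<in> borel_measurable borel"
proof -
  have "expo t = (\<lambda>x. exp (2 * of_real pi * \<i> * of_real t * of_real x))"
    by (simp add: expo_def fun_eq_iff)
  moreover have "continuous_on UNIV (\<lambda>x::real. exp (2 * of_real pi * \<i> * of_real t * of_real x :: complex))"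
    by (intro continuous_intros)
  ultimately show ?thesis by (simp only: borel_measurable_continuous_onI)
qed

lemma has_sum_extend_zero:
  assumes "(f has_sum s) A" "\<And>i. i \<in> A \<Longrightarrow> g i = f i" "\<And>i. i \<notin> A \<Longrightarrow> g i = 0"
  shows "(g has_sum s) UNIV"
  using has_sum_cong_neutral[of UNIV A g f s] assms by auto

lemma power_summable_on:
  assumes "norm (z :: complex) < 1"
  shows "(\<lambda>n. norm z ^ n) summable_on (\<Gamma> :: nat set)"
proof -
  have "(\<lambda>n. norm z ^ n) summable_on (UNIV :: nat set)"
    using assms by (intro norm_summable_imp_summable_on) (auto intro: summable_geometric)
  then show ?thesis by (rule summable_on_subset_banach) auto
qed

lemma boundary_kernel_has_sum:
  assumes "norm z < 1"
  shows "((\<lambda>\<gamma>. cnj (expo (real \<gamma>) x) * z ^ \<gamma>) has_sum cnj (boundary_kernel \<Gamma> z x)) \<Gamma>"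
proof -
  have "(\<lambda>\<gamma>. cnj (expo (real \<gamma>) x) * z ^ \<gamma>) summable_on \<Gamma>"
  proof (rule abs_summable_summable)
    show "(\<lambda>\<gamma>. norm (cnj (expo (real \<gamma>) x) * z ^ \<gamma>)) summable_on \<Gamma>"
      using power_summable_on[OF assms] by (simp add: norm_mult norm_power)
  qed
  then show ?thesis by (simp add: boundary_kernel_def)
qed

text \<open>
  The conjugate of the defining series, which exhibits \<open>k\<^sub>z\<close> itself as a series of exponentials
  with coefficients \<open>(cnj z)\<^sup>\<gamma>\<close>.
\<close>

lemma boundary_kernel_expansion:
  assumes "norm z < 1"
  shows "((\<lambda>\<gamma>. cnj z ^ \<gamma> * expo (real \<gamma>) x) has_sum boundary_kernel \<Gamma> z x) \<Gamma>"
  using has_sum_cnj_iff[THEN iffD2, OF boundary_kernel_has_sum[OF assms, of x \<Gamma>]]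
  by (simp add: mult.commute)

text \<open>
  Measurability is preserved by limits of sequences, not of arbitrary nets, so the sum over
  \<open>\<Gamma>\<close> is rewritten as a series over all natural numbers.
\<close>

lemma borel_measurable_boundary_kernel:
  assumes "norm z < 1"
  shows "boundary_kernel \<Gamma> z \<in> borel_measurable borel"
proof -
  have "boundary_kernel \<Gamma> z = (\<lambda>x. \<Sum>n. if n \<in> \<Gamma> then cnj z ^ n * expo (real n) x else 0)"
  proof
    fix x
    have "((\<lambda>n. if n \<in> \<Gamma> then cnj z ^ n * expo (real n) x else 0) has_sum boundary_kernel \<Gamma> z x) UNIV"
      using boundary_kernel_expansion[OF assms, of x \<Gamma>]
      by (rule has_sum_extend_zero) auto
    from has_sum_imp_sums[OF this]
    show "boundary_kernel \<Gamma> z x = (\<Sum>n. if n \<in> \<Gamma> then cnj z ^ n * expo (real n) x else 0)"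
      by (simp add: sums_iff)
  qed
  moreover have "(\<lambda>x. \<Sum>n. if n \<in> \<Gamma> then cnj z ^ n * expo (real n) x else 0) \<in> borel_measurable borel"
    by measurable
  ultimately show ?thesis by (simp only:)
qed

lemma boundary_kernel_l2_has_sum:
  assumes "finite_measure \<mu>" "sets \<mu> = sets borel" "norm z < 1"
  shows "l2_has_sum \<mu> (\<lambda>\<gamma> x. cnj z ^ \<gamma> * expo (real \<gamma>) x) \<Gamma> (boundary_kernel \<Gamma> z)"
proof -
  interpret finite_measure \<mu> by fact
  note [measurable_cong] = assms(2)
  show ?thesis
  proof (rule l2_has_sum_dominated)
    show "boundary_kernel \<Gamma> z \<in> borel_measurable \<mu>"
      using borel_measurable_boundary_kernel[OF assms(3)] by measurable
    show "(\<lambda>\<gamma>. norm z ^ \<gamma>) summable_on \<Gamma>" by (rule power_summable_on[OF assms(3)])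
  qed (auto simp: boundary_kernel_expansion[OF assms(3)] norm_mult norm_power)
qed

text \<open>
  The coefficient of \<open>k\<^sub>z\<close> at \<open>e\<^sub>\<gamma>\<close> is \<open>(cnj z)\<^sup>\<gamma>\<close>, and exchanging the two arguments of
  the inner product conjugates it.
\<close>

lemma boundary_kernel_inner_expo:
  assumes "finite_measure \<mu>" "sets \<mu> = sets borel" "norm z < 1"
    and on: "l2_orthonormal \<mu> (\<lambda>\<gamma>. expo (real \<gamma>)) \<Gamma>" and "\<gamma> \<in> \<Gamma>"
  shows "l2_inner \<mu> (boundary_kernel \<Gamma> z) (expo (real \<gamma>)) = z ^ \<gamma>"
proof -
  have "l2_inner \<mu> (expo (real \<gamma>)) (boundary_kernel \<Gamma> z) = cnj z ^ \<gamma>"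
    by (rule l2_orthonormal_coeff[OF on boundary_kernel_l2_has_sum[OF assms(1-3)] \<open>\<gamma> \<in> \<Gamma>\<close>])
  then show ?thesis
    unfolding l2_inner_commute[of \<mu> "boundary_kernel \<Gamma> z"] by simp
qed

text \<open>
  The reproducing property in its general form: pairing a series of exponentials with \<open>k\<^sub>z\<close>
  turns each \<open>e\<^sub>\<gamma>\<close> into \<open>z\<^sup>\<gamma>\<close>.
\<close>

lemma boundary_kernel_inner_l2_sum:
  assumes "finite_measure \<mu>" "sets \<mu> = sets borel" "norm z < 1"
    and on: "l2_orthonormal \<mu> (\<lambda>\<gamma>. expo (real \<gamma>)) \<Gamma>"
    and g: "l2_has_sum \<mu> (\<lambda>\<gamma> x. c \<gamma> * expo (real \<gamma>) x) \<Gamma> g"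
  shows "((\<lambda>\<gamma>. c \<gamma> * z ^ \<gamma>) has_sum l2_inner \<mu> (boundary_kernel \<Gamma> z) g) \<Gamma>"
proof -
  have "((\<lambda>\<gamma>. c \<gamma> * l2_inner \<mu> (boundary_kernel \<Gamma> z) (expo (real \<gamma>)))
      has_sum l2_inner \<mu> (boundary_kernel \<Gamma> z) g) \<Gamma>"
  proof (rule l2_has_sum_inner[where c = c and u = "\<lambda>\<gamma>. expo (real \<gamma>)"])
    show "l2_has_sum \<mu> (\<lambda>\<gamma> x. c \<gamma> * expo (real \<gamma>) x) \<Gamma> g" by (rule g)
    show "expo (real \<gamma>) \<in> l2_space \<mu>" if "\<gamma> \<in> \<Gamma>" for \<gamma>
      by (rule l2_orthonormalD(1)[OF on that])
    show "boundary_kernel \<Gamma> z \<in> l2_space \<mu>"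
      by (rule l2_has_sumD(2)[OF boundary_kernel_l2_has_sum[OF assms(1-3)]])
  qed
  moreover have "c \<gamma> * l2_inner \<mu> (boundary_kernel \<Gamma> z) (expo (real \<gamma>)) = c \<gamma> * z ^ \<gamma>"
    if "\<gamma> \<in> \<Gamma>" for \<gamma>
    using boundary_kernel_inner_expo[OF assms(1-4) that] by simp
  ultimately show ?thesis by (rule has_sum_cong[THEN iffD1, rotated])
qed

section \<open>Taylor coefficients\<close>

lemma taylor_coeff_eqI:
  assumes "\<And>z. norm z < 1 \<Longrightarrow> (\<lambda>n. a n * z ^ n) sums f z"
  shows "taylor_coeff f n = a n"
proof -
  have "eventually (\<lambda>z::complex. z \<in> ball 0 1) (nhds 0)"
    by (intro eventually_nhds_in_open) auto
  then have "f has_fps_expansion Abs_fps a"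
    by (intro has_fps_expansionI) (auto elim!: eventually_mono intro: assms)
  then show ?thesis
    unfolding taylor_coeff_def by (simp add: fps_expansion_eqI)
qed

text \<open>
  A function in the subspace is given by some coefficients \<open>c\<close> on \<open>\<Gamma>\<close>. Extended by zero, they
  are the coefficients of a power series with sum \<open>f\<close>, hence the Taylor coefficients of \<open>f\<close>.
\<close>

lemma hardy_subspaceD:
  assumes "f \<in> hardy_subspace \<Gamma>"
  shows "(\<lambda>\<gamma>. (norm (taylor_coeff f \<gamma>))\<^sup>2) summable_on \<Gamma>"
    and "\<And>z. norm z < 1 \<Longrightarrow> ((\<lambda>\<gamma>. taylor_coeff f \<gamma> * z ^ \<gamma>) has_sum f z) \<Gamma>"
    and "\<And>n. n \<notin> \<Gamma> \<Longrightarrow> taylor_coeff f n = 0"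
proof -
  obtain c where c: "(\<lambda>\<gamma>. (norm (c \<gamma>))\<^sup>2) summable_on \<Gamma>"
    "\<And>z. norm z < 1 \<Longrightarrow> ((\<lambda>\<gamma>. c \<gamma> * z ^ \<gamma>) has_sum f z) \<Gamma>"
    using assms by (auto simp: hardy_subspace_def)
  have coeff: "taylor_coeff f n = (if n \<in> \<Gamma> then c n else 0)" for n
  proof (rule taylor_coeff_eqI)
    fix z :: complex assume "norm z < 1"
    from c(2)[OF this] have "((\<lambda>n. (if n \<in> \<Gamma> then c n else 0) * z ^ n) has_sum f z) UNIV"
      by (rule has_sum_extend_zero) auto
    then show "(\<lambda>n. (if n \<in> \<Gamma> then c n else 0) * z ^ n) sums f z"
      by (rule has_sum_imp_sums)
  qed
  show "(\<lambda>\<gamma>. (norm (taylor_coeff f \<gamma>))\<^sup>2) summable_on \<Gamma>"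
    using c(1) by (simp add: coeff cong: summable_on_cong)
  show "((\<lambda>\<gamma>. taylor_coeff f \<gamma> * z ^ \<gamma>) has_sum f z) \<Gamma>" if "norm z < 1" for z
    using c(2)[OF that] by (simp add: coeff cong: has_sum_cong)
  show "taylor_coeff f n = 0" if "n \<notin> \<Gamma>" for n
    using that by (simp add: coeff)
qed

lemma hardy_norm_eqI:
  assumes "f \<in> hardy_subspace \<Gamma>" "((\<lambda>\<gamma>. (norm (taylor_coeff f \<gamma>))\<^sup>2) has_sum r\<^sup>2) \<Gamma>" "r \<ge> 0"
  shows "hardy_norm f = r"
proof -
  have "((\<lambda>n. (norm (taylor_coeff f n))\<^sup>2) has_sum r\<^sup>2) UNIV"
    using assms(2) hardy_subspaceD(3)[OF assms(1)]
    by (auto intro: has_sum_extend_zero)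
  then have "(\<Sum>n. (norm (taylor_coeff f n))\<^sup>2) = r\<^sup>2"
    by (auto dest: has_sum_imp_sums simp: sums_iff)
  then show ?thesis using assms(3) by (simp add: hardy_norm_def)
qed

section \<open>The boundary representation\<close>

lemma spectral_pair_l2_orthonormal:
  assumes "spectral_pair \<mu> (real ` \<Gamma>)"
  shows "l2_orthonormal \<mu> (\<lambda>\<gamma>. expo (real \<gamma>)) \<Gamma>"
  using assms unfolding spectral_pair_def l2_orthonormal_basis_def l2_orthonormal_def by auto

text \<open>
  Polynomials enter the general reproducing property as series with finitely many nonzero
  terms: the partial sums are eventually equal to the boundary function.
\<close>

lemma gamma_polys_l2_has_sum:
  assumes "f \<in> gamma_polys \<Gamma>" and e: "\<And>\<gamma>. \<gamma> \<in> \<Gamma> \<Longrightarrow> expo (real \<gamma>) \<in> l2_space \<mu>"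
  obtains c where "l2_has_sum \<mu> (\<lambda>\<gamma> x. c \<gamma> * expo (real \<gamma>) x) \<Gamma> (poly_tilde f)"
    "\<And>z. ((\<lambda>\<gamma>. c \<gamma> * z ^ \<gamma>) has_sum f z) \<Gamma>"
proof -
  obtain F a where F: "finite F" "F \<subseteq> \<Gamma>" and f: "f = (\<lambda>z. \<Sum>\<gamma>\<in>F. a \<gamma> * z ^ \<gamma>)"
    using assms(1) by (auto simp: gamma_polys_def)
  define c where "c \<gamma> = (if \<gamma> \<in> F then a \<gamma> else 0)" for \<gamma>
  have tilde: "poly_tilde f = (\<lambda>x. \<Sum>\<gamma>\<in>F. c \<gamma> * expo (real \<gamma>) x)"
    by (simp add: fun_eq_iff poly_tilde_def f expo_of_nat c_def)
  have sum_eq: "(\<Sum>\<gamma>\<in>G. c \<gamma> * v \<gamma>) = (\<Sum>\<gamma>\<in>F. c \<gamma> * v \<gamma>)" if "finite G" "F \<subseteq> G" for G v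
    by (rule sum.mono_neutral_right) (use that in \<open>auto simp: c_def\<close>)
  show ?thesis
  proof
    have zero: "l2_norm \<mu> (\<lambda>x. (\<Sum>\<gamma>\<in>G. c \<gamma> * expo (real \<gamma>) x) - poly_tilde f x) = 0"
      if "finite G" "F \<subseteq> G" for G
      unfolding tilde sum_eq[OF that] by (simp add: l2_norm_def)
    have "eventually (\<lambda>G. l2_norm \<mu> (\<lambda>x. (\<Sum>\<gamma>\<in>G. c \<gamma> * expo (real \<gamma>) x) - poly_tilde f x) = 0)
        (finite_subsets_at_top \<Gamma>)"
      unfolding eventually_finite_subsets_at_top
      using F zero by blast
    moreover have "poly_tilde f \<in> l2_space \<mu>"
      unfolding tilde using F e by (intro l2_space_sum l2_space_cmult) auto
    ultimately show "l2_has_sum \<mu> (\<lambda>\<gamma> x. c \<gamma> * expo (real \<gamma>) x) \<Gamma> (poly_tilde f)"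
      unfolding l2_has_sum_def using e by (auto intro: l2_space_cmult tendsto_eventually)
    show "((\<lambda>\<gamma>. c \<gamma> * z ^ \<gamma>) has_sum f z) \<Gamma>" for z
      by (rule has_sum_finite_neutralI[OF F]) (auto simp: f c_def)
  qed
qed

theorem proposition2p4:
  fixes X :: "real set" and \<mu> :: "real measure" and \<Gamma> :: "nat set"
    and k :: "complex \<Rightarrow> real \<Rightarrow> complex"
  assumes "compact X" and "X \<subseteq> {0..1}"
    and "prob_space \<mu>" and "sets \<mu> = sets borel" and "emeasure \<mu> (UNIV - X) = 0"
    and "spectral_pair \<mu> (real ` \<Gamma>)"
  defines "k \<equiv> boundary_kernel \<Gamma>"
  shows
    "(\<forall>z\<in>ball 0 1. \<forall>x\<in>X.
        ((\<lambda>\<gamma>. cnj (expo (real \<gamma>) x) * z ^ \<gamma>) has_sum cnj (k z x)) \<Gamma>) \<and>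
     has_boundary_representation X \<mu> \<Gamma> k \<and>
     (\<forall>z\<in>ball 0 1. \<forall>w\<in>ball 0 1.
        ((\<lambda>\<gamma>. (z * cnj w) ^ \<gamma>) has_sum l2_inner \<mu> (k z) (k w)) \<Gamma>) \<and>
     (\<forall>f\<in>gamma_polys \<Gamma>. \<forall>z\<in>ball 0 1.
        f z = (LINT x:X|\<mu>. cnj (k z x) * poly_tilde f x) \<and>
        f z = l2_inner \<mu> (k z) (poly_tilde f)) \<and>
     (\<forall>f\<in>hardy_subspace \<Gamma>.
        (\<exists>g. is_hardy_tilde \<mu> \<Gamma> f g) \<and>
        (\<forall>g. is_hardy_tilde \<mu> \<Gamma> f g \<longrightarrow>
           g \<in> l2_space (restrict_space \<mu> X) \<and>
           (\<forall>z\<in>ball 0 1.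
              f z = (LINT x:X|\<mu>. cnj (k z x) * g x) \<and>
              f z = l2_inner \<mu> (k z) g) \<and>
           hardy_norm f = l2_norm \<mu> g))"
proof -
  have fin: "finite_measure \<mu>"
    using assms(3) by (rule prob_space.finite_measure)
  have on: "l2_orthonormal \<mu> (\<lambda>\<gamma>. expo (real \<gamma>)) \<Gamma>"
    by (rule spectral_pair_l2_orthonormal) fact
  have X: "X \<in> sets \<mu>"
    using assms(1,4) by (simp add: compact_imp_closed)
  have null: "emeasure \<mu> (space \<mu> - X) = 0"
    using assms(5) sets_eq_imp_space_eq[OF assms(4)] by simp
  note series = boundary_kernel_l2_has_sum[OF fin assms(4)]
  note inner = boundary_kernel_inner_l2_sum[OF fin assms(4) _ on]
  have k_mem: "k z \<in> l2_space \<mu>" if "norm z < 1" for z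
    unfolding k_def by (rule l2_has_sumD(2)[OF series[OF that]])
  \<comment> \<open>The complement of X is a null set, so integrals over X and over the line agree.\<close>
  have on_X: "(LINT x:X|\<mu>. cnj (k z x) * g x) = l2_inner \<mu> (k z) g"
    if "norm z < 1" "g \<in> l2_space \<mu>" for z g
    unfolding l2_inner_def
    using l2_integrable_mult[OF l2_space_cnj[OF k_mem[OF that(1)]] that(2)]
    by (intro set_integral_full X null) auto
  have gram: "((\<lambda>\<gamma>. (z * cnj w) ^ \<gamma>) has_sum l2_inner \<mu> (k z) (k w)) \<Gamma>"
    if "norm z < 1" "norm w < 1" for z w
    using inner[OF that(1) series[OF that(2)]] by (simp add: k_def power_mult_distrib mult.commute)
  have poly: "f z = (LINT x:X|\<mu>. cnj (k z x) * poly_tilde f x) \<and> f z = l2_inner \<mu> (k z) (poly_tilde f)"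
    if f: "f \<in> gamma_polys \<Gamma>" and z: "norm z < 1" for f z
  proof -
    obtain c where c: "l2_has_sum \<mu> (\<lambda>\<gamma> x. c \<gamma> * expo (real \<gamma>) x) \<Gamma> (poly_tilde f)"
      "\<And>z. ((\<lambda>\<gamma>. c \<gamma> * z ^ \<gamma>) has_sum f z) \<Gamma>"
      using gamma_polys_l2_has_sum[OF f l2_orthonormalD(1)[OF on]] by blast
    have "f z = l2_inner \<mu> (k z) (poly_tilde f)"
      unfolding k_def by (rule has_sum_unique[OF c(2) inner[OF z c(1)]])
    then show ?thesis using on_X[OF z l2_has_sumD(2)[OF c(1)]] by simp
  qed
  have hardy_ex: "\<exists>g. is_hardy_tilde \<mu> \<Gamma> f g" if "f \<in> hardy_subspace \<Gamma>" for f
    unfolding is_hardy_tilde_def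
    using finite_measure.riesz_fischer[OF fin on hardy_subspaceD(1)[OF that]] by blast
  have hardy: "g \<in> l2_space (restrict_space \<mu> X) \<and>
      (\<forall>z\<in>ball 0 1. f z = (LINT x:X|\<mu>. cnj (k z x) * g x) \<and> f z = l2_inner \<mu> (k z) g) \<and>
      hardy_norm f = l2_norm \<mu> g"
    if f: "f \<in> hardy_subspace \<Gamma>" and "is_hardy_tilde \<mu> \<Gamma> f g" for f g
  proof -
    have g: "l2_has_sum \<mu> (\<lambda>\<gamma> x. taylor_coeff f \<gamma> * expo (real \<gamma>) x) \<Gamma> g"
      using that(2) by (simp add: is_hardy_tilde_def)
    have "f z = l2_inner \<mu> (k z) g" if "norm z < 1" for z
      unfolding k_def by (rule has_sum_unique[OF hardy_subspaceD(2)[OF f that] inner[OF that g]])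
    moreover have "hardy_norm f = l2_norm \<mu> g"
      by (rule hardy_norm_eqI[OF f l2_orthonormal_parseval[OF on g] l2_norm_nonneg])
    ultimately show ?thesis
      using l2_has_sumD(2)[OF g] X on_X by (auto simp: l2_space_restrict_space)
  qed
  have "has_boundary_representation X \<mu> \<Gamma> k"
    unfolding has_boundary_representation_def
    using k_mem X poly by (auto simp: l2_space_restrict_space)
  moreover have "((\<lambda>\<gamma>. cnj (expo (real \<gamma>) x) * z ^ \<gamma>) has_sum cnj (k z x)) \<Gamma>" if "norm z < 1" for z x
    unfolding k_def by (rule boundary_kernel_has_sum[OF that])
  ultimately show ?thesis
    using gram poly hardy_ex hardy by (intro conjI ballI allI impI) (simp_all add: dist_norm)
qed

end
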